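(* Let $D\in\mathbb{N}$ and let $A_1,\dots,A_D\subset\mathbb{N}$ satisfy $A_1=\Pr(A_D)$ and $A_{j+1}=\Pr(A_j)$ for each $j\in\{1,\dots,D-1\}$. Then $D=2d$ for some $d\in\mathbb{N}$, and $A_{2j-1}=A_1$ and $A_{2j}=A_2$ for each $j\in\{1,\dots,d\}$.
   Context: For $m\in\mathbb{N}$, $D(m)$ is the set of positive divisors of $m$. For $A\subset\mathbb{N}$, $S_A=\sum_{a\in A}a$ ($S_\emptyset=0$, $S_A=+\infty$ for infinite $A$), and $A$ is a practical set if every non-negative integer $k\le S_A$ is a sum of distinct elements of $A$. A number $m\in\mathbb{N}$ is $A$-practical if $D(m)\cap A$ is a practical set, and $\Pr(A)$ is the set of all $A$-practical numbers. *)

theory Defs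
  imports Main "HOL-Library.Extended_Nat"
begin

text \<open>Here the natural numbers start at 1, so subsets of them are sets of
  type \<^typ>\<open>nat set\<close> that do not contain 0.\<close>

definition pos_divisors :: "nat \<Rightarrow> nat set" where
  "pos_divisors m = {d. 0 < d \<and> d dvd m}"

definition set_total :: "nat set \<Rightarrow> enat" where
  "set_total A = (if finite A then enat (\<Sum>a\<in>A. a) else \<infinity>)"

text \<open>A sum of distinct elements of \<open>A\<close> is the sum over a finite subset of \<open>A\<close>;
  the empty sum 0 is allowed, so the empty set is practical.\<close>

definition practical_set :: "nat set \<Rightarrow> bool" where
  "practical_set A \<longleftrightarrow>
     (\<forall>k::nat. enat k \<le> set_total A \<longrightarrow> (\<exists>B. finite B \<and> B \<subseteq> A \<and> k = (\<Sum>b\<in>B. b)))"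

definition practical_wrt :: "nat set \<Rightarrow> nat \<Rightarrow> bool" where
  "practical_wrt A m \<longleftrightarrow> practical_set (pos_divisors m \<inter> A)"

definition Pr :: "nat set \<Rightarrow> nat set" where
  "Pr A = {m. 0 < m \<and> practical_wrt A m}"

end

theory Submission
  imports Defs
begin

text \<open>Listed increasingly, a finite set is practical iff each element is at most one more than the
  sum of its predecessors. Hence whether \<open>m \<in> Pr A\<close> depends on \<open>m \<in> A\<close> and on the proper
  divisors of \<open>m\<close> in \<open>A\<close>, and with the latter fixed it is a constant or the negation of
  \<open>m \<in> A\<close>. For \<open>m = 3\<close> it is always the negation, so every cycle has even length. By strong
  induction on \<open>m\<close>, two steps of the cycle act on the truth value of \<open>m \<in> A\<close> by a constant or by the
  identity, which is an idempotent map; around a cycle this forces period two.\<close>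

lemma practical_set_iff:
  assumes "finite P" "0 \<notin> P"
  shows "practical_set P \<longleftrightarrow> (\<forall>a\<in>P. a \<le> Suc (\<Sum>{b\<in>P. b < a}))"
proof
  assume P: "practical_set P"
  show "\<forall>a\<in>P. a \<le> Suc (\<Sum>{b\<in>P. b < a})"
  proof
    fix a assume a: "a \<in> P"
    have "0 < a" using a assms(2) by (cases a) auto
    have "a \<le> \<Sum>P" using a assms(1) member_le_sum[of a P "\<lambda>x. x"] by simp
    \<comment> \<open>Representing \<open>a - 1\<close> rather than \<open>a\<close> forces every
      summand to be smaller than \<open>a\<close>; positivity of \<open>a\<close> makes this
      strict.\<close>
    then have "enat (a - 1) \<le> set_total P" using assms(1) by (simp add: set_total_def)
    then obtain B where B: "finite B" "B \<subseteq> P" "a - 1 = \<Sum>B"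
      using P by (auto simp: practical_set_def)
    have "b < a" if "b \<in> B" for b
      using member_le_sum[of b B "\<lambda>x. x"] that B \<open>0 < a\<close> by simp
    with B have "B \<subseteq> {b\<in>P. b < a}" by auto
    then have "\<Sum>B \<le> \<Sum>{b\<in>P. b < a}" using assms(1) by (intro sum_mono2) auto
    with B show "a \<le> Suc (\<Sum>{b\<in>P. b < a})" by simp
  qed
next
  assume "\<forall>a\<in>P. a \<le> Suc (\<Sum>{b\<in>P. b < a})"
  with assms(1) have "\<forall>k\<le>\<Sum>P. \<exists>B\<subseteq>P. k = \<Sum>B"
  proof (induction P rule: finite_linorder_max_induct)
    case empty
    then show ?case by auto
  next
    case (insert m P)
    have "{b \<in> insert m P. b < a} = {b\<in>P. b < a}" if "a \<in> P" for a
      using insert.hyps(2) that by fastforce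
    with insert.prems have "\<forall>a\<in>P. a \<le> Suc (\<Sum>{b\<in>P. b < a})" by simp
    note IH = insert.IH[OF this]
    have "m \<notin> P" using insert.hyps(2) by blast
    have "{b \<in> insert m P. b < m} = P" using insert.hyps(2) by auto
    with insert.prems have m: "m \<le> Suc (\<Sum>P)" by (metis insertI1)
    show ?case
    proof (intro allI impI)
      fix k assume k: "k \<le> \<Sum>(insert m P)"
      show "\<exists>B\<subseteq>insert m P. k = \<Sum>B"
      proof (cases "k \<le> \<Sum>P")
        case True
        then show ?thesis using IH by blast
      next
        case False
        \<comment> \<open>Now \<open>k\<close> exceeds \<open>\<Sum>P\<close>, so the gap bound on
          \<open>m\<close> gives \<open>m \<le> k\<close>: the subtraction does not truncate, and
          adding \<open>m\<close> to a representation of \<open>k - m\<close> recovers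
          \<open>k\<close>.\<close>
        have "k - m \<le> \<Sum>P" using k \<open>m \<notin> P\<close> insert.hyps(1) by simp
        then obtain B where B: "B \<subseteq> P" "k - m = \<Sum>B" using IH by blast
        have "finite B" using B(1) insert.hyps(1) by (rule finite_subset)
        moreover have "m \<notin> B" using B(1) \<open>m \<notin> P\<close> by blast
        ultimately have "\<Sum>(insert m B) = k" using B(2) False m by simp
        then show ?thesis using B(1) by (intro exI[of _ "insert m B"]) auto
      qed
    qed
  qed
  note sums = this
  show "practical_set P"
    unfolding practical_set_def
  proof (intro allI impI)
    fix k assume "enat k \<le> set_total P"
    then have "k \<le> \<Sum>P" using assms(1) by (simp add: set_total_def)
    then obtain B where "B \<subseteq> P" "k = \<Sum>B" using sums by blast
    then show "\<exists>B. finite B \<and> B \<subseteq> P \<and> k = (\<Sum>b\<in>B. b)"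
      using assms(1) finite_subset by blast
  qed
qed

lemma mem_Pr_iff:
  assumes "0 < m"
  shows "m \<in> Pr A \<longleftrightarrow>
    (\<forall>a\<in>A. a dvd m \<longrightarrow> a \<le> Suc (\<Sum>{b\<in>A. b dvd m \<and> b < a}))"
proof -
  let ?P = "pos_divisors m \<inter> A"
  have "finite ?P" "0 \<notin> ?P"
    using assms by (auto simp: pos_divisors_def)
  moreover have "?P = {d\<in>A. d dvd m}"
    using assms by (auto simp: pos_divisors_def dvd_pos_nat)
  ultimately show ?thesis
    using assms practical_set_iff[of ?P] by (auto simp: Pr_def practical_wrt_def)
qed

lemma one_mem_Pr: "1 \<in> Pr A"
  by (simp add: mem_Pr_iff)

text \<open>Only 1 precedes 3 among the divisors of 3, and 3 is greater than \<open>Suc 1\<close>.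
  This flip detects the parity of the cycle length.\<close>

lemma three_mem_Pr_iff:
  assumes "1 \<in> A"
  shows "3 \<in> Pr A \<longleftrightarrow> 3 \<notin> A"
proof -
  have dvd3: "b dvd 3 \<longleftrightarrow> b = 1 \<or> b = 3" for b :: nat
  proof
    assume "b dvd 3"
    moreover from this have "b \<le> 3" by (simp add: dvd_imp_le)
    moreover have "b \<noteq> 0" "b \<noteq> 2" using \<open>b dvd 3\<close> by (auto intro: ccontr)
    ultimately show "b = 1 \<or> b = 3" by linarith
  qed auto
  have "{b\<in>A. b dvd 3 \<and> b < 3} = {1}" using assms by (auto simp: dvd3)
  then show ?thesis by (auto simp: mem_Pr_iff dvd3)
qed

text \<open>Splitting off the divisor \<open>m\<close> itself isolates the dependence on
  \<open>m \<in> A\<close>; the other conditions involve proper divisors only, which suits induction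
  on \<open>m\<close>.\<close>

lemma mem_Pr_iff_proper:
  assumes "0 < m"
  shows "m \<in> Pr A \<longleftrightarrow>
    (\<forall>a\<in>A. a dvd m \<and> a < m \<longrightarrow> a \<le> Suc (\<Sum>{b\<in>A. b dvd m \<and> b < a})) \<and>
    (m \<in> A \<longrightarrow> m \<le> Suc (\<Sum>{b\<in>A. b dvd m \<and> b < m}))"
proof -
  have "a dvd m \<longleftrightarrow> a dvd m \<and> a < m \<or> a = m" for a
    using dvd_imp_le[of a m] assms by auto
  then show ?thesis unfolding mem_Pr_iff[OF assms] by blast
qed

lemma Pr_cycle_period_two:
  fixes B :: "nat \<Rightarrow> nat set"
  assumes step: "\<And>n. B (Suc n) = Pr (B n)" and period: "\<And>n. B (n + 2 * d) = B n" and "0 < d"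
  shows "B (n + 2) = B n"
proof -
  have nonzero: "0 \<notin> B n" for n
    \<comment> \<open>Going once around the cycle gives even \<open>B 0\<close> a predecessor, so
      each \<open>B n\<close> is a value of \<open>Pr\<close>.\<close>
    using step[of "n + 2 * d - 1"] period[of n] \<open>0 < d\<close> by (simp add: Pr_def)
  have "m \<in> B (n + 2) \<longleftrightarrow> m \<in> B n" for m n
  proof (induction m arbitrary: n rule: less_induct)
    case (less m)
    show ?case
    proof (cases "m = 0")
      case True
      then show ?thesis using nonzero by simp
    next
      case False
      \<comment> \<open>Both \<open>q\<close> and \<open>t\<close> see only proper divisors of
        \<open>m\<close>, so the induction hypothesis makes them 2-periodic in the index.\<close>
      define q where
        "q n \<longleftrightarrow> (\<forall>a\<in>B n. a dvd m \<and> a < m \<longrightarrow> a \<le> Suc (\<Sum>{b\<in>B n. b dvd m \<and> b < a}))" for n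
      define t where "t n \<longleftrightarrow> m \<le> Suc (\<Sum>{b\<in>B n. b dvd m \<and> b < m})" for n
      have x: "m \<in> B (Suc n) \<longleftrightarrow> q n \<and> (m \<in> B n \<longrightarrow> t n)" for n
        unfolding step q_def t_def using False by (simp add: mem_Pr_iff_proper)
      have sets: "{b \<in> B (n + 2). b dvd m \<and> b < a} = {b \<in> B n. b dvd m \<and> b < a}" if "a \<le> m" for a n
        using less.IH[of _ n] that by (intro Collect_cong) auto
      have t: "t (n + 2) = t n" for n
        unfolding t_def by (simp only: sets[OF order_refl])
      have q: "q (n + 2) = q n" for n
      proof -
        have "(a \<in> B (n + 2) \<longrightarrow> a dvd m \<and> a < m \<longrightarrow>
              a \<le> Suc (\<Sum>{b\<in>B (n + 2). b dvd m \<and> b < a})) \<longleftrightarrow>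
            (a \<in> B n \<longrightarrow> a dvd m \<and> a < m \<longrightarrow>
              a \<le> Suc (\<Sum>{b\<in>B n. b dvd m \<and> b < a}))" for a
          using less.IH[of a n] sets[of a n] by (cases "a < m") simp_all
        then show ?thesis unfolding q_def Ball_def by (simp only:)
      qed
      have two: "m \<in> B (n + 2) \<longleftrightarrow> q (n + 1) \<and> (q n \<and> (m \<in> B n \<longrightarrow> t n) \<longrightarrow> t (n + 1))" for n
        using x[of n] x[of "n + 1"] by simp
      \<comment> \<open>One step is antitone in the truth value of \<open>m \<in> B n\<close>, so
        two steps are monotone. A monotone map on two truth values is constant or the identity,
        hence idempotent, and by \<open>q\<close> and \<open>t\<close> the same map acts again from
        \<open>n + 2\<close>.\<close>
      have idem: "m \<in> B (n + 4) \<longleftrightarrow> m \<in> B (n + 2)" for n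
      proof -
        have "n + 4 = (n + 2) + 2" "n + 2 + 1 = (n + 1) + 2" by simp_all
        then have "m \<in> B (n + 4) \<longleftrightarrow>
            q (n + 1) \<and> (q n \<and> (m \<in> B (n + 2) \<longrightarrow> t n) \<longrightarrow> t (n + 1))"
          using two[of "n + 2"] by (simp only: q t)
        with two[of n] show ?thesis by argo
      qed
      have "m \<in> B (n + 2 + 2 * i) \<longleftrightarrow> m \<in> B (n + 2)" for i
      proof (induction i)
        case (Suc i)
        have "n + 2 * i + 4 = n + 2 + 2 * Suc i" "n + 2 * i + 2 = n + 2 + 2 * i" by simp_all
        then show ?case using Suc idem[of "n + 2 * i"] by metis
      qed simp
      \<comment> \<open>Membership is constant along \<open>n + 2\<close>, \<open>n + 4\<close>, and
        so on; as \<open>d\<close> is positive, this list reaches \<open>n + 2 * d\<close>, where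
        the cycle is back at \<open>B n\<close>.\<close>
      moreover have "n + 2 + 2 * (d - 1) = n + 2 * d" using \<open>0 < d\<close> by simp
      ultimately show ?thesis using period[of n] by metis
    qed
  qed
  then show ?thesis by blast
qed

theorem theorem4p14:
  fixes D :: nat and A :: "nat \<Rightarrow> nat set"
  assumes "1 \<le> D"
    and "\<And>j. j \<in> {1..D} \<Longrightarrow> A j \<subseteq> {0<..}"
    and "A 1 = Pr (A D)"
    and "\<And>j. j \<in> {1..D - 1} \<Longrightarrow> A (j + 1) = Pr (A j)"
  shows "\<exists>d::nat. 1 \<le> d \<and> D = 2 * d \<and>
           (\<forall>j\<in>{1..d}. A (2 * j - 1) = A 1 \<and> A (2 * j) = A 2)"
proof -
  \<comment> \<open>Unrolls the cycle over all indices, shifted so that \<open>B 0\<close> is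
    \<open>A 1\<close>; the wrap-around step is the hypothesis on \<open>A D\<close>.\<close>
  define B where "B n = A (Suc (n mod D))" for n
  have step: "B (Suc n) = Pr (B n)" for n
  proof (cases "Suc (n mod D) = D")
    case True
    then show ?thesis using assms(3) by (simp add: B_def mod_Suc)
  next
    case False
    have "n mod D < D" using assms(1) by simp
    then have "Suc (n mod D) \<in> {1..D - 1}" using False by auto
    then show ?thesis using assms(4) False by (simp add: B_def mod_Suc)
  qed
  have period: "B (n + D) = B n" for n by (simp add: B_def)
  have one: "1 \<in> B n" for n
    using step[of "n + D - 1"] period[of n] assms(1) one_mem_Pr by simp
  \<comment> \<open>Membership of 3 flips at every step, so returning to \<open>B 0\<close> after
    \<open>D\<close> steps requires \<open>D\<close> to be even.\<close>
  have "3 \<in> B n \<longleftrightarrow> (even n \<longleftrightarrow> 3 \<in> B 0)" for n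
  proof (induction n)
    case (Suc n)
    then show ?case using three_mem_Pr_iff[OF one[of n]] by (auto simp: step)
  qed simp
  from this[of D] have "even D" using period[of 0] by auto
  then obtain d where d: "D = 2 * d" by blast
  with assms(1) have "0 < d" by simp
  have two: "B (n + 2) = B n" for n
    using Pr_cycle_period_two[of B d n] step period d \<open>0 < d\<close> by simp
  have B: "B (2 * i + n) = B n" for i n
  proof (induction i)
    case (Suc i)
    then show ?case using two[of "2 * i + n"] by (simp add: algebra_simps)
  qed simp
  have A: "A (Suc n) = B n" if "n < D" for n using that by (simp add: B_def)
  have "A (2 * j - 1) = A 1 \<and> A (2 * j) = A 2" if j: "j \<in> {1..d}" for j
  proof -
    obtain i where i: "j = Suc i" using j by (cases j) auto
    show ?thesis
      using A[of "2 * i"] A[of "2 * i + 1"] A[of 0] A[of 1] B[of i 0] B[of i 1] j d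
      by (simp add: i numeral_2_eq_2)
  qed
  then show ?thesis using d \<open>0 < d\<close> by (intro exI[of _ d]) auto
qed

end
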